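(* Let $(S,\mathcal B(S))$ be a standard Borel space and let $(P_t)_{t\ge0}$ be a Markov semigroup on $S$. Assume that $(P_t)_{t\ge0}$ is $\psi$-irreducible for some $\sigma$-finite measure $\psi$ on $(S,\mathcal B(S))$, that is, for every $A\in\mathcal B(S)$ with $\psi(A)>0$ and every $x\in S$ there exists $t>0$ such that $P_t(x,A)>0$. Assume moreover that for every $x\in S$ and every $A\in\mathcal B(S)$ the map $t\mapsto P_t(x,A)$ is right-continuous on $(0,\infty)$. Then, for every $\alpha>0$, $$\psi\ll R_\alpha(x,\cdot)\qquad\text{for all }x\in S,$$ where $R_\alpha(x,A):=\alpha\int_0^\infty e^{-\alpha t}P_t(x,A)\,dt$.
   Context: A Markov semigroup $(P_t)_{t\ge0}$ on $S$ is a family of Markov transition kernels on $(S,\mathcal B(S))$ such that $P_0(x,\cdot)=\delta_x$ and $P_{t+s}(x,A)=\int_S P_t(y,A)\,P_s(x,dy)$ for all $t,s\ge0$, $x\in S$, $A\in\mathcal B(S)$. The kernel $R_\alpha$ is called the normalized resolvent kernel of the semigroup. For measures $\nu,\lambda$ on $(S,\mathcal B(S))$, $\nu\ll\lambda$ means that $\lambda(A)=0$ implies $\nu(A)=0$ for every $A\in\mathcal B(S)$. *)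

theory Defs
  imports "HOL-Probability.Probability"
begin

text \<open>Polish spaces are rendered through the library's topologies on an arbitrary carrier, so the
  state space is the carrier of a measure \<open>M\<close>. Only the \<open>\<sigma>\<close>-algebra of \<open>M\<close> is used; its measure
  values are irrelevant.\<close>

definition standard_borel_space :: "'a measure \<Rightarrow> bool" where
  "standard_borel_space M \<longleftrightarrow>
     (\<exists>X. completely_metrizable_space X \<and> separable_space X \<and>
          sets M = sets (sigma (topspace X) {U. openin X U}))"

text \<open>The index set is \<open>[0, \<infinity>)\<close>: nothing is required of \<open>P t\<close> for negative \<open>t\<close>. Membership in
  \<open>M \<rightarrow>\<^sub>M prob_algebra M\<close> says that \<open>P t x\<close> is a probability measure on \<open>M\<close> and that
  \<open>x \<mapsto> P t x A\<close> is measurable for every \<open>A \<in> sets M\<close>.\<close>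

definition markov_semigroup :: "'a measure \<Rightarrow> (real \<Rightarrow> 'a \<Rightarrow> 'a measure) \<Rightarrow> bool" where
  "markov_semigroup M P \<longleftrightarrow>
     (\<forall>t\<ge>0. P t \<in> M \<rightarrow>\<^sub>M prob_algebra M) \<and>
     (\<forall>x\<in>space M. P 0 x = return M x) \<and>
     (\<forall>t\<ge>0. \<forall>s\<ge>0. \<forall>x\<in>space M. \<forall>A\<in>sets M.
        emeasure (P (t + s) x) A = (\<integral>\<^sup>+ y. emeasure (P t y) A \<partial>(P s x)))"

definition psi_irreducible ::
    "'a measure \<Rightarrow> (real \<Rightarrow> 'a \<Rightarrow> 'a measure) \<Rightarrow> 'a measure \<Rightarrow> bool" where
  "psi_irreducible M P \<psi> \<longleftrightarrow>
     (\<forall>A\<in>sets M. emeasure \<psi> A > 0 \<longrightarrow> (\<forall>x\<in>space M. \<exists>t>0. emeasure (P t x) A > 0))"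

definition right_continuous_semigroup ::
    "'a measure \<Rightarrow> (real \<Rightarrow> 'a \<Rightarrow> 'a measure) \<Rightarrow> bool" where
  "right_continuous_semigroup M P \<longleftrightarrow>
     (\<forall>x\<in>space M. \<forall>A\<in>sets M. \<forall>t>0. continuous (at_right t) (\<lambda>t. measure (P t x) A))"

definition resolvent ::
    "'a measure \<Rightarrow> (real \<Rightarrow> 'a \<Rightarrow> 'a measure) \<Rightarrow> real \<Rightarrow> 'a \<Rightarrow> 'a measure" where
  "resolvent M P \<alpha> x = measure_of (space M) (sets M)
     (\<lambda>A. ennreal \<alpha> * (\<integral>\<^sup>+ t\<in>{0..}. ennreal (exp (- \<alpha> * t)) * emeasure (P t x) A \<partial>lborel))"

text \<open>\<^const>\<open>measure_of\<close> returns the zero measure when its argument is not countably additive. The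
  rest of this theory shows that this does not happen for a right-continuous Markov semigroup, so
  that \<^term>\<open>resolvent M P \<alpha> x\<close> really has the values given by the integral.\<close>

lemma right_continuous_borel_measurable:
  fixes f :: "real \<Rightarrow> real"
  assumes "\<And>t. t > 0 \<Longrightarrow> continuous (at_right t) f"
  shows "(\<lambda>t. indicator {0<..} t * f t) \<in> borel_measurable borel"
proof (rule borel_measurable_LIMSEQ_real)
  define r where "r n t = (of_int \<lfloor>real (Suc n) * t\<rfloor> + 1) / real (Suc n)" for n t
  show "(\<lambda>n. indicator {0<..} t * f (r n t)) \<longlonglongrightarrow> indicator {0<..} t * f t" for t :: real
  proof (cases "t > 0")
    case True
    have gt: "r n t > t" for n
      using floor_correct[of "real (Suc n) * t"] unfolding r_def
      by (simp add: field_simps del: of_nat_Suc)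
    have le: "r n t \<le> t + 1 / real (Suc n)" for n
      using floor_correct[of "real (Suc n) * t"] unfolding r_def
      by (simp add: field_simps del: of_nat_Suc)
    have "(\<lambda>n. t + 1 / real (Suc n)) \<longlonglongrightarrow> t + 0"
      by (intro tendsto_add tendsto_const LIMSEQ_Suc[OF lim_1_over_n])
    then have lim: "(\<lambda>n. t + 1 / real (Suc n)) \<longlonglongrightarrow> t" by simp
    have "(\<lambda>n. r n t) \<longlonglongrightarrow> t"
      by (rule real_tendsto_sandwich[OF _ _ tendsto_const lim])
        (use gt le in \<open>simp_all add: less_imp_le del: of_nat_Suc\<close>)
    then have "filterlim (\<lambda>n. r n t) (at_right t) sequentially"
      using less_imp_neq[OF gt, symmetric] gt by (simp add: filterlim_at)
    moreover have "(f \<longlongrightarrow> f t) (at_right t)"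
      using assms[OF True] by (simp add: continuous_within)
    ultimately show ?thesis
      by (intro tendsto_mult tendsto_const) (rule filterlim_compose)
  qed simp
  show "(\<lambda>t. indicator {0<..} t * f (r n t)) \<in> borel_measurable borel" for n
  proof -
    have "(\<lambda>t. f ((of_int \<lfloor>real (Suc n) * t\<rfloor> + 1) / real (Suc n))) \<in> borel_measurable borel"
      by (rule measurable_compose_countable'[where I = UNIV and
            f = "\<lambda>k t. f ((of_int k + 1) / real (Suc n))" and g = "\<lambda>t. \<lfloor>real (Suc n) * t\<rfloor>"]) auto
    then show ?thesis unfolding r_def by measurable
  qed
qed

lemma emeasure_resolvent:
  assumes P: "markov_semigroup M P" and rc: "right_continuous_semigroup M P"
    and x: "x \<in> space M" and A: "A \<in> sets M"
  shows "emeasure (resolvent M P \<alpha> x) A =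
    ennreal \<alpha> * (\<integral>\<^sup>+ t\<in>{0..}. ennreal (exp (- \<alpha> * t)) * emeasure (P t x) A \<partial>lborel)"
proof -
  let ?g = "\<lambda>t A. ennreal (exp (- \<alpha> * t)) * emeasure (P t x) A * indicator {0..} t"
  let ?h = "\<lambda>t A. ennreal (exp (- \<alpha> * t)) * ennreal (indicator {0<..} t * measure (P t x) A)"
  let ?\<mu> = "\<lambda>A. ennreal \<alpha> * (\<integral>\<^sup>+ t. ?g t A \<partial>lborel)"
  have Pt: "prob_space (P t x)" "sets (P t x) = sets M" if "t \<ge> 0" for t
  proof -
    have "P t \<in> M \<rightarrow>\<^sub>M prob_algebra M" using P that by (simp add: markov_semigroup_def)
    then have "P t x \<in> space (prob_algebra M)" using x by (rule measurable_space)
    then show "prob_space (P t x)" "sets (P t x) = sets M" by (auto simp: space_prob_algebra)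
  qed
  have hm [measurable]: "(\<lambda>t. ?h t B) \<in> borel_measurable lborel" if "B \<in> sets M" for B
  proof -
    have "(\<lambda>t. indicator {0<..} t * measure (P t x) B) \<in> borel_measurable borel"
      using rc x that
      by (intro right_continuous_borel_measurable) (auto simp: right_continuous_semigroup_def)
    then show ?thesis by measurable
  qed
  have gh: "?g t B = ?h t B" if "t \<noteq> 0" for t B
  proof (cases "t > 0")
    case True
    then interpret prob_space "P t x" by (intro Pt) simp
    show ?thesis using True by (simp add: emeasure_eq_measure)
  qed (use that in \<open>simp add: indicator_def\<close>)
  have AE0: "AE t in lborel. t \<noteq> (0::real)" by (rule AE_lborel_singleton)
  have \<mu>h: "?\<mu> B = ennreal \<alpha> * (\<integral>\<^sup>+ t. ?h t B \<partial>lborel)" for B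
    using AE0 gh by (intro arg_cong2[where f = times] refl nn_integral_cong_AE) auto
  have "countably_additive (sets M) ?\<mu>"
  proof (rule countably_additiveI)
    fix B :: "nat \<Rightarrow> 'a set"
    assume B: "range B \<subseteq> sets M" "disjoint_family B" "\<Union> (range B) \<in> sets M"
    have "(\<Sum>i. ?\<mu> (B i)) = ennreal \<alpha> * (\<Sum>i. \<integral>\<^sup>+ t. ?h t (B i) \<partial>lborel)"
      by (simp only: \<mu>h ennreal_suminf_cmult)
    also have "(\<Sum>i. \<integral>\<^sup>+ t. ?h t (B i) \<partial>lborel) = (\<integral>\<^sup>+ t. (\<Sum>i. ?h t (B i)) \<partial>lborel)"
      using B hm by (intro nn_integral_suminf[symmetric]) auto
    also have "\<dots> = (\<integral>\<^sup>+ t. ?g t (\<Union> (range B)) \<partial>lborel)"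
    proof (rule nn_integral_cong_AE)
      have "(\<Sum>i. ?h t (B i)) = ?g t (\<Union> (range B))" if "t \<noteq> 0" for t
      proof (cases "t > 0")
        case True
        have "(\<Sum>i. emeasure (P t x) (B i)) = emeasure (P t x) (\<Union> (range B))"
          using B Pt(2)[of t] True by (intro suminf_emeasure) auto
        then show ?thesis using True unfolding gh[OF that, symmetric] by simp
      qed (use that in \<open>simp add: indicator_def\<close>)
      then show "AE t in lborel. (\<Sum>i. ?h t (B i)) = ?g t (\<Union> (range B))"
        using AE0 by auto
    qed
    finally show "(\<Sum>i. ?\<mu> (B i)) = ?\<mu> (\<Union> (range B))" .
  qed
  moreover have "positive (sets M) ?\<mu>" by (simp add: positive_def)
  ultimately show ?thesis
    unfolding resolvent_def by (rule emeasure_measure_of_sigma[OF sets.sigma_algebra_axioms _ _ A, rotated])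
qed

end

theory Submission
  imports Defs
begin

text \<open>Let \<open>\<psi> A > 0\<close>. Irreducibility gives a time \<open>t > 0\<close> with \<open>P t x A > 0\<close>. One such time has
  Lebesgue measure zero and says nothing about the resolvent; right-continuity turns it into an
  interval \<open>(t, u)\<close> on which \<open>P s x A\<close> stays above half its value at \<open>t\<close>. The weight
  \<open>exp (- \<alpha> * s)\<close> is bounded below on that bounded interval, so the resolvent integral is
  positive. Hence a null set of the resolvent is a null set of \<open>\<psi>\<close>.\<close>

lemma right_continuous_interval_gt_half:
  fixes f :: "real \<Rightarrow> real"
  assumes "continuous (at_right t) f" and "f t > 0"
  obtains u where "u > t" and "\<And>s. t < s \<Longrightarrow> s < u \<Longrightarrow> f s > f t / 2"
proof -
  have "(f \<longlongrightarrow> f t) (at_right t)" using assms(1) by (simp add: continuous_within)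
  then have "eventually (\<lambda>s. f s > f t / 2) (at_right t)"
    using assms(2) by (intro order_tendstoD) auto
  then show thesis using that unfolding eventually_at_right_field by blast
qed

text \<open>The integrand dominates \<open>c\<close> times the indicator of the interval, whose integral
  \<open>c * (u - t)\<close> is positive.\<close>

lemma nn_integral_pos_of_interval:
  fixes c :: real and f :: "real \<Rightarrow> ennreal"
  assumes "c > 0" and "t < u" and "\<And>s. t < s \<Longrightarrow> s < u \<Longrightarrow> ennreal c \<le> f s"
  shows "(\<integral>\<^sup>+ s. f s \<partial>lborel) > 0"
proof -
  have "0 < ennreal c * emeasure lborel {t<..<u}"
    using assms(1,2) by (simp add: ennreal_zero_less_mult_iff)
  also have "\<dots> = (\<integral>\<^sup>+ s. ennreal c * indicator {t<..<u} s \<partial>lborel)"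
    by (simp add: nn_integral_cmult_indicator)
  also have "\<dots> \<le> (\<integral>\<^sup>+ s. f s \<partial>lborel)"
    using assms(3) by (intro nn_integral_mono) (auto simp: indicator_def)
  finally show ?thesis .
qed

lemma emeasure_resolvent_pos:
  assumes P: "markov_semigroup M P" and rc: "right_continuous_semigroup M P"
    and x: "x \<in> space M" and A: "A \<in> sets M" and "\<alpha> > 0"
    and t: "t > 0" "emeasure (P t x) A > 0"
  shows "emeasure (resolvent M P \<alpha> x) A > 0"
proof -
  have prob: "prob_space (P s x)" if "s \<ge> 0" for s
    using measurable_space[of "P s" M "prob_algebra M" x] P x that
    by (auto simp: markov_semigroup_def space_prob_algebra)
  have meas: "emeasure (P s x) A = ennreal (measure (P s x) A)" if "s \<ge> 0" for s
  proof -
    interpret prob_space "P s x" by (rule prob[OF that])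
    show ?thesis by (rule emeasure_eq_measure)
  qed
  let ?m = "measure (P t x) A"
  have m: "?m > 0" using t meas[of t] by simp
  have "continuous (at_right t) (\<lambda>s. measure (P s x) A)"
    using rc x A t(1) by (auto simp: right_continuous_semigroup_def)
  then obtain u where u: "u > t" "\<And>s. t < s \<Longrightarrow> s < u \<Longrightarrow> measure (P s x) A > ?m / 2"
    using right_continuous_interval_gt_half[of t "\<lambda>s. measure (P s x) A"] m by blast
  have "(\<integral>\<^sup>+ s\<in>{0..}. ennreal (exp (- \<alpha> * s)) * emeasure (P s x) A \<partial>lborel) > 0"
  proof (rule nn_integral_pos_of_interval[OF _ u(1)])
    show "exp (- \<alpha> * u) * (?m / 2) > 0" using m by simp
    fix s assume s: "t < s" "s < u"
    have "exp (- \<alpha> * u) * (?m / 2) \<le> exp (- \<alpha> * s) * measure (P s x) A"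
      using s u(2)[OF s] m \<open>\<alpha> > 0\<close> by (intro mult_mono) auto
    then show "ennreal (exp (- \<alpha> * u) * (?m / 2))
        \<le> ennreal (exp (- \<alpha> * s)) * emeasure (P s x) A * indicator {0..} s"
      using s t(1) by (simp add: meas ennreal_mult[symmetric] ennreal_leI)
  qed
  then show ?thesis
    using \<open>\<alpha> > 0\<close> by (simp add: emeasure_resolvent[OF P rc x A] ennreal_zero_less_mult_iff)
qed

theorem theorem3p8:
  fixes M \<psi> :: "'a measure" and P :: "real \<Rightarrow> 'a \<Rightarrow> 'a measure"
  assumes "standard_borel_space M"
    and "markov_semigroup M P"
    and "sets \<psi> = sets M" and "sigma_finite_measure \<psi>"
    and "psi_irreducible M P \<psi>"
    and "right_continuous_semigroup M P"
  shows "\<forall>\<alpha>>0. \<forall>x\<in>space M. absolutely_continuous (resolvent M P \<alpha> x) \<psi>"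
proof (intro allI impI ballI)
  fix \<alpha> :: real and x assume "\<alpha> > 0" and x: "x \<in> space M"
  show "absolutely_continuous (resolvent M P \<alpha> x) \<psi>"
    unfolding absolutely_continuous_def
  proof
    fix A assume null: "A \<in> null_sets (resolvent M P \<alpha> x)"
    then have A: "A \<in> sets M" by (auto simp: null_sets_def resolvent_def)
    have "emeasure \<psi> A = 0"
    proof (rule ccontr)
      assume "emeasure \<psi> A \<noteq> 0"
      then obtain t where "t > 0" "emeasure (P t x) A > 0"
        using assms(5) A x unfolding psi_irreducible_def by (meson zero_less_iff_neq_zero)
      then have "emeasure (resolvent M P \<alpha> x) A > 0"
        by (rule emeasure_resolvent_pos[OF assms(2,6) x A \<open>\<alpha> > 0\<close>])
      with null show False by (simp add: null_sets_def)
    qed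
    then show "A \<in> null_sets \<psi>" using A assms(3) by (simp add: null_sets_def)
  qed
qed

end
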